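(* Let $T>0$, let $n$ be a positive integer, $\tau=T/n$, $\beta>0$ and $c=\beta/\tau^2$. Let $B\in\mathbb{R}^{(n+1)\times(n+1)}$ be the time-discretization matrix with parameters $\alpha,\beta,\tau$ (defined in the context). If $\alpha=\frac{1}{\tau}+\frac{\tau}{\beta}$ and $c>1$, then $B$ has $n+1$ distinct eigenvalues. In particular, the nonsymmetric matrix $B$ is diagonalizable.
   Context: Index rows and columns of $B$ by $0,1,\dots,n$. The matrix $B$ is $$B=\begin{bmatrix}\alpha&0&0&\cdots&0&1/\beta\\-1&1/\tau&0&\cdots&0&0\\-1&-1/\tau&1/\tau&0&\cdots&0\\\vdots&0&\ddots&\ddots&\ddots&0\\-1&0&\cdots&-1/\tau&1/\tau&0\\-1&0&\cdots&0&-1/\tau&1/\tau\end{bmatrix}.$$ That is: $B_{0,0}=\alpha$; $B_{0,n}=1/\beta$; $B_{k,0}=-1$ and $B_{k,k}=1/\tau$ for $1\le k\le n$; $B_{k,k-1}=-1/\tau$ for $2\le k\le n$; all other entries are $0$. Eigenvalues are complex, and diagonalizability is over $\mathbb{C}$. *)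

theory Defs
  imports Complex_Main "Jordan_Normal_Form.Char_Poly"
begin

text \<open>Rows and columns are indexed by \<open>0, \<dots>, n\<close>. The entry \<open>(1, 0)\<close> is \<open>-1\<close>:
  the subdiagonal entries \<open>-1/\<tau>\<close> only start in row \<open>2\<close>, so the test \<open>j = 0\<close> comes first.\<close>

definition time_disc_mat :: "nat \<Rightarrow> real \<Rightarrow> real \<Rightarrow> real \<Rightarrow> real mat" where
  "time_disc_mat n \<alpha> \<beta> \<tau> = mat (n + 1) (n + 1) (\<lambda>(i, j).
     if i = 0 then (if j = 0 then \<alpha> else if j = n then 1 / \<beta> else 0)
     else if j = 0 then - 1
     else if j = i then 1 / \<tau>
     else if j + 1 = i then - 1 / \<tau>
     else 0)"

definition diagonalizable_mat :: "'a :: field mat \<Rightarrow> bool" where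
  "diagonalizable_mat A \<longleftrightarrow> (\<exists>D. diagonal_mat D \<and> similar_mat A D)"

end

theory Submission
  imports Defs
    "Jordan_Normal_Form.Jordan_Normal_Form_Existence"
    "Jordan_Normal_Form.Spectral_Radius"
begin

text \<open>Putting \<open>\<lambda> = (1 - w) / \<tau>\<close>, the rows \<open>1, \<dots>, n\<close> of the eigenvalue equation become a recurrence
  whose solution, inserted into row \<open>0\<close>, leaves the polynomial equation
  \<open>c w\<^sup>n\<^sup>+\<^sup>1 + w\<^sup>n + \<dots> + w + 1 = 0\<close>. Multiplied by \<open>w - 1\<close>, its left-hand side becomes
  \<open>c w\<^sup>n\<^sup>+\<^sup>2 + (1 - c) w\<^sup>n\<^sup>+\<^sup>1 - 1\<close>, whose only nonzero critical point is
  \<open>(c - 1) (n + 1) / (c (n + 2))\<close>. For \<open>c > 1\<close> this is a positive real number, where the original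
  polynomial is positive; so all its \<open>n + 1\<close> roots are simple.\<close>

lemma diagonal_jordan_matrix:
  assumes "\<And>k a. (k, a) \<in> set n_as \<Longrightarrow> k = 1"
  shows "diagonal_mat (jordan_matrix n_as)"
  using assms
proof (induction n_as)
  case Nil
  then show ?case by (simp add: jordan_matrix_def diagonal_mat_def)
next
  case (Cons x xs)
  obtain a where x: "x = (1, a)" using Cons.prems by (cases x) auto
  have "diagonal_mat (jordan_matrix xs)" using Cons by auto
  then show ?case unfolding x jordan_matrix_Cons
    by (auto simp: diagonal_mat_def)
qed

lemma order_prod_list_linear:
  fixes as :: "'a :: field list"
  assumes "distinct as"
  shows "order b (\<Prod>a\<leftarrow>as. [:- a, 1:]) = (if b \<in> set as then 1 else 0)"
  using assms
proof (induction as)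
  case (Cons a as)
  have "[:- a, 1:] * (\<Prod>a\<leftarrow>as. [:- a, 1:]) \<noteq> 0"
    by (auto simp: prod_list_zero_iff simp del: mult_pCons_left)
  then show ?case
    using Cons by (auto simp: order_mult order_linear' simp del: mult_pCons_left)
qed simp

text \<open>The size of a Jordan block is at most the multiplicity of its eigenvalue in
  \<open>char_poly A\<close>. With \<open>n\<close> different roots among \<open>n\<close> linear
  factors every multiplicity is at most 1, so all blocks have size 1.\<close>

lemma diagonalizable_mat_if_card_eigenvalues:
  fixes A :: "complex mat"
  assumes A: "A \<in> carrier_mat n n" and card: "card {z. eigenvalue A z} = n"
  shows "diagonalizable_mat A"
proof -
  obtain as where as: "char_poly A = (\<Prod>a\<leftarrow>as. [:- a, 1:])" "length as = n"
    using char_poly_factorized[OF A] by auto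
  obtain n_as where jnf: "jordan_nf A n_as" using jordan_nf_exists[OF A as(1)] by blast
  have "{z. eigenvalue A z} = set as"
    by (auto simp: eigenvalue_root_char_poly[OF A] as(1) poly_prod_list prod_list_zero_iff)
  then have dist: "distinct as" using card as(2) by (metis card_distinct)
  then have order: "order a (char_poly A) \<le> 1" for a
    by (simp add: as(1) order_prod_list_linear)
  have "k = 1" if "(k, a) \<in> set n_as" for k a
  proof -
    have "k \<le> 1" using jordan_nf_block_size_order_bound[OF jnf that] order[of a] by simp
    \<comment> \<open>\<open>jordan_nf\<close> itself excludes empty blocks.\<close>
    moreover have "k \<noteq> 0" using jnf that by (force simp: jordan_nf_def)
    ultimately show ?thesis by simp
  qed
  then have "diagonal_mat (jordan_matrix n_as)" by (rule diagonal_jordan_matrix)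
  then show ?thesis using jnf by (auto simp: diagonalizable_mat_def jordan_nf_def)
qed

lemma card_roots_rsquarefree:
  fixes p :: "complex poly"
  assumes "rsquarefree p"
  shows "card {z. poly p z = 0} = degree p"
proof -
  have p0: "p \<noteq> 0" using assms by (simp add: rsquarefree_def)
  have "degree (Polynomial.smult (lead_coeff p) (\<Prod>z | poly p z = 0. [:- z, 1:]))
      = (\<Sum>z | poly p z = 0. degree [:- z, 1:])"
    using p0 by (simp add: degree_prod_eq_sum_degree)
  then show ?thesis using complex_poly_decompose_rsquarefree[OF assms] by simp
qed

definition red_poly :: "real \<Rightarrow> nat \<Rightarrow> complex poly" where
  "red_poly c n = monom (of_real c) (n + 1) + (\<Sum>i\<le>n. monom 1 i)"

lemma poly_red_poly: "poly (red_poly c n) w = of_real c * w ^ (n + 1) + (\<Sum>i\<le>n. w ^ i)"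
  by (simp add: red_poly_def poly_monom poly_sum)

lemma degree_red_poly:
  assumes "c \<noteq> 0"
  shows "degree (red_poly c n) = n + 1"
proof (rule antisym)
  show "degree (red_poly c n) \<le> n + 1"
    unfolding red_poly_def
    by (intro degree_add_le degree_sum_le order.trans[OF degree_monom_le]) auto
  have "coeff (red_poly c n) (n + 1) \<noteq> 0"
    using assms by (simp add: red_poly_def coeff_sum)
  then show "n + 1 \<le> degree (red_poly c n)" by (rule le_degree)
qed

text \<open>The constant term is 1. This permits cancelling \<open>w ^ n\<close> below and makes the
  eigenvector nonzero.\<close>

lemma root_red_poly_nonzero: "poly (red_poly c n) w = 0 \<Longrightarrow> w \<noteq> 0"
  by (auto simp: poly_red_poly power_0_left)

lemma red_poly_telescope:
  "[:-1, 1:] * red_poly c n = monom (of_real c) (n + 2) + monom (1 - of_real c) (n + 1) - 1"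
proof (rule poly_ext)
  fix w :: complex
  have "(w - 1) * (\<Sum>i\<le>n. w ^ i) = w ^ (n + 1) - 1"
    using power_diff_1_eq[of w "n + 1"] by (simp add: lessThan_Suc_atMost)
  then show "poly ([:-1, 1:] * red_poly c n) w
      = poly (monom (of_real c) (n + 2) + monom (1 - of_real c) (n + 1) - 1) w"
    by (simp add: poly_red_poly poly_monom algebra_simps)
qed

lemma rsquarefree_red_poly:
  assumes c: "c > 1"
  shows "rsquarefree (red_poly c n)"
  unfolding rsquarefree_roots
proof (intro allI notI, elim conjE)
  fix w
  assume root: "poly (red_poly c n) w = 0" and "poly (pderiv (red_poly c n)) w = 0"
  \<comment> \<open>By the product rule, a multiple root stays a critical point after multiplication
    by any factor.\<close>
  then have "poly (pderiv ([:-1, 1:] * red_poly c n)) w = 0"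
    by (simp add: pderiv_mult del: mult_pCons_left)
  then have "of_nat (n + 2) * of_real c * w ^ (n + 1) + of_nat (n + 1) * (1 - of_real c) * w ^ n = 0"
    unfolding red_poly_telescope by (simp add: pderiv_diff pderiv_add pderiv_monom poly_monom)
  then have "w ^ n * (of_nat (n + 2) * of_real c * w - of_nat (n + 1) * (of_real c - 1)) = 0"
    by (simp add: algebra_simps)
  then have *: "of_nat (n + 2) * of_real c * w = of_nat (n + 1) * (of_real c - 1)"
    using root_red_poly_nonzero[OF root] by simp
  define x where "x = real (n + 1) * (c - 1) / (real (n + 2) * c)"
  have "of_nat (n + 2) * complex_of_real c \<noteq> 0"
    using c by (simp del: of_nat_add of_nat_Suc)
  then have "w = of_nat (n + 1) * (of_real c - 1) / (of_nat (n + 2) * of_real c)"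
    using * by (metis nonzero_mult_div_cancel_left)
  then have w: "w = of_real x" by (simp add: x_def)
  \<comment> \<open>Here \<open>c > 1\<close> is decisive. All coefficients of
    \<open>red_poly c n\<close> are positive, so it has no positive real root.\<close>
  have "x > 0" using c by (simp add: x_def)
  then have "c * x ^ (n + 1) + (\<Sum>i\<le>n. x ^ i) > 0"
    using c by (intro add_pos_nonneg mult_pos_pos zero_less_power sum_nonneg zero_le_power) auto
  moreover have "of_real (c * x ^ (n + 1) + (\<Sum>i\<le>n. x ^ i)) = (0::complex)"
    using root unfolding poly_red_poly w by simp
  ultimately show False by (metis less_irrefl of_real_eq_0_iff)
qed

lemma time_disc_mat_eigenvalue:
  fixes \<alpha> \<beta> \<tau> c :: real
  assumes n: "n > 0" and \<tau>: "\<tau> > 0" and \<beta>: "\<beta> > 0" and c: "c = \<beta> / \<tau>\<^sup>2"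
    and \<alpha>: "\<alpha> = 1 / \<tau> + \<tau> / \<beta>"
    and root: "poly (red_poly c n) w = 0"
  shows "eigenvalue (map_mat complex_of_real (time_disc_mat n \<alpha> \<beta> \<tau>)) ((1 - w) / of_real \<tau>)"
proof -
  define B where "B = map_mat complex_of_real (time_disc_mat n \<alpha> \<beta> \<tau>)"
  \<comment> \<open>Starting from 1 in position 0, the recurrence gives \<open>\<tau>\<close> times
    the sum of w^(-i) for i from 1 to \<open>k\<close>. Scaling by \<open>w ^ n\<close> clears the
    negative powers.\<close>
  define f where "f k = of_real \<tau> * w ^ (n - k) * (\<Sum>i<k. w ^ i)" for k
  define v where "v = vec (n + 1) (\<lambda>k. if k = 0 then w ^ n else f k)"
  have dim: "dim_row B = n + 1" "dim_col B = n + 1" by (simp_all add: B_def time_disc_mat_def)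
  have rec: "w * f (Suc k) = of_real \<tau> * w ^ n + f k" if "k < n" for k
  proof -
    have "w * w ^ (n - Suc k) = w ^ (n - k)"
      by (metis Suc_diff_Suc power_Suc that)
    moreover have "w ^ (n - k) * w ^ k = w ^ n"
      using that by (simp flip: power_add)
    moreover have "w * f (Suc k) = of_real \<tau> * (w * w ^ (n - Suc k)) * ((\<Sum>i<k. w ^ i) + w ^ k)"
      by (simp add: f_def)
    ultimately show ?thesis
      by (simp add: f_def algebra_simps)
  qed
  \<comment> \<open>Row 0: since \<open>\<tau>\<^sup>2 / \<beta>\<close> is 1/c, multiplying by
    \<open>c * \<tau>\<close> and cancelling c w^n turns this into the root equation.\<close>
  have top: "of_real \<alpha> * w ^ n + f n / of_real \<beta> = (1 - w) / of_real \<tau> * w ^ n"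
  proof -
    have "(\<Sum>i\<le>n. w ^ i) = (\<Sum>i<n. w ^ i) + w ^ n"
      by (simp flip: lessThan_Suc_atMost)
    then have "(\<Sum>i<n. w ^ i) = - (of_real c * w * w ^ n + w ^ n)"
      using root by (simp add: poly_red_poly add_eq_0_iff algebra_simps)
    then show ?thesis
      using \<tau> \<beta> by (simp add: f_def c \<alpha> field_simps power2_eq_square)
  qed
  have mult: "(B *\<^sub>v v) $ k = (\<Sum>j\<in>{0..<n+1}. B $$ (k, j) * v $ j)" if "k < n + 1" for k
    using that by (simp add: scalar_prod_def dim v_def)
  have "B *\<^sub>v v = ((1 - w) / of_real \<tau>) \<cdot>\<^sub>v v"
  proof (rule eq_vecI)
    fix k assume "k < dim_vec (((1 - w) / of_real \<tau>) \<cdot>\<^sub>v v)"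
    then have k: "k < n + 1" by (simp add: v_def)
    show "(B *\<^sub>v v) $ k = (((1 - w) / of_real \<tau>) \<cdot>\<^sub>v v) $ k"
    proof (cases k)
      case 0
      have "(\<Sum>j\<in>{0..<n+1}. B $$ (k, j) * v $ j) = (\<Sum>j\<in>{0, n}. B $$ (k, j) * v $ j)"
        using k 0 by (intro sum.mono_neutral_right) (auto simp: B_def time_disc_mat_def)
      also have "\<dots> = of_real \<alpha> * w ^ n + f n / of_real \<beta>"
        using 0 n by (simp add: B_def time_disc_mat_def v_def)
      finally show ?thesis
        using top by (simp add: mult[OF k]) (simp add: 0 v_def)
    next
      case (Suc m)
      have m: "m < n" using Suc k by simp
      have "(\<Sum>j\<in>{0..<n+1}. B $$ (k, j) * v $ j) = (\<Sum>j\<in>{0, m, Suc m}. B $$ (k, j) * v $ j)"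
        using k Suc by (intro sum.mono_neutral_right) (auto simp: B_def time_disc_mat_def)
      \<comment> \<open>For \<open>m = 0\<close> the index set collapses to two elements and row 1
        has no subdiagonal term; \<open>f 0 = 0\<close> keeps the formula valid.\<close>
      also have "\<dots> = - (w ^ n) - f m / of_real \<tau> + f (Suc m) / of_real \<tau>"
        using Suc m by (cases m) (auto simp: B_def time_disc_mat_def v_def f_def)
      also have "\<dots> = (1 - w) / of_real \<tau> * f (Suc m)"
        using rec[OF m] \<tau> by (simp add: field_simps)
      finally show ?thesis
        using k by (simp add: mult[OF k]) (simp add: Suc v_def)
    qed
  qed (simp add: dim v_def)
  moreover have "v \<noteq> 0\<^sub>v (n + 1)"
  proof
    assume "v = 0\<^sub>v (n + 1)"
    then have "v $ 0 = 0" by simp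
    then show False using root_red_poly_nonzero[OF root] by (simp add: v_def)
  qed
  moreover have "v \<in> carrier_vec (n + 1)" by (simp add: v_def)
  ultimately show ?thesis
    unfolding eigenvalue_def eigenvector_def B_def[symmetric] dim by blast
qed

theorem lemma3p1:
  fixes T \<tau> \<alpha> \<beta> c :: real and n :: nat and B :: "real mat"
  assumes "T > 0" and "n > 0" and "\<tau> = T / real n"
    and "\<beta> > 0" and "c = \<beta> / \<tau>\<^sup>2"
    and "B = time_disc_mat n \<alpha> \<beta> \<tau>"
    and "\<alpha> = 1 / \<tau> + \<tau> / \<beta>" and "c > 1"
  shows "card {z :: complex. eigenvalue (map_mat complex_of_real B) z} = n + 1
    \<and> transpose_mat B \<noteq> B
    \<and> diagonalizable_mat (map_mat complex_of_real B)"
proof -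
  have \<tau>: "\<tau> > 0" using assms by simp
  let ?A = "map_mat complex_of_real B"
  let ?R = "{w. poly (red_poly c n) w = 0}"
  have A: "?A \<in> carrier_mat (n + 1) (n + 1)"
    by (simp add: assms(6) time_disc_mat_def)
  have "inj_on (\<lambda>w. (1 - w) / complex_of_real \<tau>) ?R"
    using \<tau> by (auto simp: inj_on_def)
  then have "card ((\<lambda>w. (1 - w) / complex_of_real \<tau>) ` ?R) = n + 1"
    using assms(8) by (simp add: card_image card_roots_rsquarefree rsquarefree_red_poly degree_red_poly)
  moreover have "(\<lambda>w. (1 - w) / complex_of_real \<tau>) ` ?R \<subseteq> spectrum ?A"
    using time_disc_mat_eigenvalue[OF assms(2) \<tau> assms(4,5,7)] assms(6)
    by (auto simp: spectrum_def)
  ultimately have "n + 1 \<le> card (spectrum ?A)"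
    using card_mono[OF card_finite_spectrum(1)[OF A]] by metis
  then have card: "card {z. eigenvalue ?A z} = n + 1"
    using card_finite_spectrum(2)[OF A] by (simp add: spectrum_def)
  \<comment> \<open>Entry (1, 0) is -1, whereas entry (0, 1) is 0 or, for \<open>n = 1\<close>, the
    positive number \<open>1 / \<beta>\<close>.\<close>
  have "transpose_mat B $$ (0, 1) \<noteq> B $$ (0, 1)"
  proof -
    have "1 / \<beta> > 0" using assms(4) by simp
    then have "- 1 \<noteq> 1 / \<beta>" by linarith
    then show ?thesis using assms(2) by (auto simp: assms(6) time_disc_mat_def)
  qed
  then show ?thesis
    using card diagonalizable_mat_if_card_eigenvalues[OF A card] by metis
qed

end
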